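(* For $\varepsilon=\pm1$, every prime power $q>2$ and every integer $m\ge 2$, the affine polar graph $\mathrm{VO}^\varepsilon_{2m}(q)$ is not triply transitive.
   Context: $\mathrm{VO}^\varepsilon_{2m}(q)$ has vertex set $\mathbb F_q^{2m}$, equipped with a non-degenerate quadratic form $Q$ of type $\varepsilon$ (hyperbolic for $\varepsilon=+1$, elliptic for $\varepsilon=-1$); distinct $x,y$ are adjacent iff $Q(x-y)=0$. For a strongly regular graph $\Gamma=(V,E)$: $A_0=I$, $A_1$ its adjacency matrix, $A_2=J-I-A_1$; for a vertex $\omega$, $E^*_{i,\omega}$ ($i=0,1,2$) is the diagonal matrix whose diagonal is the $\omega$-row of $A_i$; $T_\omega$ is the algebra generated by $A_0,A_1,A_2,E^*_{0,\omega},E^*_{1,\omega},E^*_{2,\omega}$; $T_{0,\omega}$ is the span of all $E^*_{i,\omega}A_jE^*_{k,\omega}$; $\tilde T_\omega$ is the algebra of complex matrices commuting with the permutation matrices of the stabilizer $G_\omega$ in $G=\mathrm{Aut}(\Gamma)$. $\Gamma$ is triply transitive if $G$ is transitive and $T_{0,\omega}=T_\omega=\tilde T_\omega$ for some (equivalently every) vertex $\omega$. *)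

theory Defs
  imports "HOL-Analysis.Analysis"
begin

definition polar_form :: "('a::field ^ 'n \<Rightarrow> 'a) \<Rightarrow> 'a ^ 'n \<Rightarrow> 'a ^ 'n \<Rightarrow> 'a" where
  "polar_form Q x y = Q (x + y) - Q x - Q y"

definition quadratic_form :: "('a::field ^ 'n \<Rightarrow> 'a) \<Rightarrow> bool" where
  "quadratic_form Q \<longleftrightarrow>
     (\<forall>c x. Q (c *s x) = c ^ 2 * Q x) \<and>
     (\<forall>x. Vector_Spaces.linear (*s) (*) (\<lambda>y. polar_form Q x y)) \<and>
     (\<forall>y. Vector_Spaces.linear (*s) (*) (\<lambda>x. polar_form Q x y))"

text \<open>
  Valid in every characteristic: no nonzero singular vector lies in the radical of the polar form.
  In odd characteristic the condition \<open>Q x = 0\<close> is implied by the other one, and over a finite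
  field in even dimension the radical of the polar form is then zero in characteristic 2 as well.
\<close>
definition nondegenerate_form :: "('a::field ^ 'n \<Rightarrow> 'a) \<Rightarrow> bool" where
  "nondegenerate_form Q \<longleftrightarrow> (\<forall>x. Q x = 0 \<and> (\<forall>y. polar_form Q x y = 0) \<longrightarrow> x = 0)"

definition totally_singular :: "('a::field ^ 'n \<Rightarrow> 'a) \<Rightarrow> ('a ^ 'n) set \<Rightarrow> bool" where
  "totally_singular Q W \<longleftrightarrow> vec.subspace W \<and> (\<forall>x\<in>W. Q x = 0)"

definition witt_index :: "('a::field ^ 'n \<Rightarrow> 'a) \<Rightarrow> nat" where
  "witt_index Q = Max {vec.dim W | W. totally_singular Q W}"

text \<open>
  A form on a space of dimension \<open>2m\<close> is hyperbolic if its Witt index is \<open>m\<close> and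
  elliptic if it is \<open>m - 1\<close>.
\<close>
definition hyperbolic :: "('a::field ^ 'n \<Rightarrow> 'a) \<Rightarrow> bool" where
  "hyperbolic Q \<longleftrightarrow> CARD('n) = 2 * witt_index Q"

definition elliptic :: "('a::field ^ 'n \<Rightarrow> 'a) \<Rightarrow> bool" where
  "elliptic Q \<longleftrightarrow> CARD('n) = 2 * (witt_index Q + 1)"

definition form_type :: "int \<Rightarrow> ('a::field ^ 'n \<Rightarrow> 'a) \<Rightarrow> bool" where
  "form_type \<epsilon> Q \<longleftrightarrow> (\<epsilon> = 1 \<and> hyperbolic Q) \<or> (\<epsilon> = - 1 \<and> elliptic Q)"

text \<open>Graphs are given by their adjacency relation on a vertex type.\<close>

definition VO_adj :: "('a::field ^ 'n \<Rightarrow> 'a) \<Rightarrow> 'a ^ 'n \<Rightarrow> 'a ^ 'n \<Rightarrow> bool" where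
  "VO_adj Q x y \<longleftrightarrow> x \<noteq> y \<and> Q (x - y) = 0"

definition mat_scale :: "complex \<Rightarrow> complex ^ 'v ^ 'v \<Rightarrow> complex ^ 'v ^ 'v" where
  "mat_scale c M = (\<chi> x y. c * M $ x $ y)"

interpretation cmat: vector_space mat_scale
  by unfold_locales (simp_all add: mat_scale_def vec_eq_iff algebra_simps)

text \<open>The unit is not required here; the generating sets used below contain it.\<close>
definition matrix_algebra :: "(complex ^ 'v ^ 'v) set \<Rightarrow> bool" where
  "matrix_algebra S \<longleftrightarrow> cmat.subspace S \<and> (\<forall>M\<in>S. \<forall>N\<in>S. M ** N \<in> S)"

definition all_ones :: "complex ^ 'v ^ 'v" where
  "all_ones = (\<chi> x y. 1)"

definition adj_matrix :: "('v::finite \<Rightarrow> 'v \<Rightarrow> bool) \<Rightarrow> complex ^ 'v ^ 'v" where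
  "adj_matrix adj = (\<chi> x y. if adj x y then 1 else 0)"

text \<open>The matrices $A_0, A_1, A_2$; only the indices 0, 1 and 2 are ever used.\<close>
definition scheme_matrix :: "('v::finite \<Rightarrow> 'v \<Rightarrow> bool) \<Rightarrow> nat \<Rightarrow> complex ^ 'v ^ 'v" where
  "scheme_matrix adj i =
     (if i = 0 then mat 1
      else if i = 1 then adj_matrix adj
      else all_ones - mat 1 - adj_matrix adj)"

text \<open>The dual idempotents $E^*_{i,\omega}$.\<close>
definition dual_idempotent ::
    "('v::finite \<Rightarrow> 'v \<Rightarrow> bool) \<Rightarrow> 'v \<Rightarrow> nat \<Rightarrow> complex ^ 'v ^ 'v" where
  "dual_idempotent adj \<omega> i = (\<chi> x y. if x = y then scheme_matrix adj i $ \<omega> $ x else 0)"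

definition terwilliger_algebra ::
    "('v::finite \<Rightarrow> 'v \<Rightarrow> bool) \<Rightarrow> 'v \<Rightarrow> (complex ^ 'v ^ 'v) set" where
  "terwilliger_algebra adj \<omega> =
     matrix_algebra hull (scheme_matrix adj ` {0, 1, 2} \<union> dual_idempotent adj \<omega> ` {0, 1, 2})"

definition terwilliger_T0 ::
    "('v::finite \<Rightarrow> 'v \<Rightarrow> bool) \<Rightarrow> 'v \<Rightarrow> (complex ^ 'v ^ 'v) set" where
  "terwilliger_T0 adj \<omega> =
     cmat.span {dual_idempotent adj \<omega> i ** scheme_matrix adj j ** dual_idempotent adj \<omega> k
                | i j k. i \<in> {0, 1, 2} \<and> j \<in> {0, 1, 2} \<and> k \<in> {0, 1, 2}}"

definition graph_aut :: "('v \<Rightarrow> 'v \<Rightarrow> bool) \<Rightarrow> ('v \<Rightarrow> 'v) set" where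
  "graph_aut adj = {g. bij g \<and> (\<forall>x y. adj (g x) (g y) \<longleftrightarrow> adj x y)}"

definition vertex_stabilizer :: "('v \<Rightarrow> 'v \<Rightarrow> bool) \<Rightarrow> 'v \<Rightarrow> ('v \<Rightarrow> 'v) set" where
  "vertex_stabilizer adj \<omega> = {g \<in> graph_aut adj. g \<omega> = \<omega>}"

definition permutation_matrix :: "('v::finite \<Rightarrow> 'v) \<Rightarrow> complex ^ 'v ^ 'v" where
  "permutation_matrix g = (\<chi> x y. if x = g y then 1 else 0)"

definition stabilizer_centralizer ::
    "('v::finite \<Rightarrow> 'v \<Rightarrow> bool) \<Rightarrow> 'v \<Rightarrow> (complex ^ 'v ^ 'v) set" where
  "stabilizer_centralizer adj \<omega> =
     {M. \<forall>g\<in>vertex_stabilizer adj \<omega>. M ** permutation_matrix g = permutation_matrix g ** M}"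

definition vertex_transitive :: "('v \<Rightarrow> 'v \<Rightarrow> bool) \<Rightarrow> bool" where
  "vertex_transitive adj \<longleftrightarrow> (\<forall>x y. \<exists>g\<in>graph_aut adj. g x = y)"

text \<open>
  Used for strongly regular graphs. The choice of \<open>\<omega>\<close> is immaterial because of
  vertex transitivity.
\<close>
definition triply_transitive :: "('v::finite \<Rightarrow> 'v \<Rightarrow> bool) \<Rightarrow> bool" where
  "triply_transitive adj \<longleftrightarrow>
     vertex_transitive adj \<and>
     (\<exists>\<omega>. terwilliger_T0 adj \<omega> = terwilliger_algebra adj \<omega> \<and>
          terwilliger_algebra adj \<omega> = stabilizer_centralizer adj \<omega>)"

end

theory Submission
  imports Defs
begin

text \<open>
  If \<open>T\<^sub>0 = T\<close> at \<open>\<omega>\<close>, then \<open>A\<^sub>1 E\<^sup>*\<^sub>1 A\<^sub>1\<close> lies in \<open>T\<^sub>0\<close>, so the number of common neighbours of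
  \<open>\<omega>\<close>, \<open>x\<close>, \<open>y\<close> depends only on the adjacencies among these vertices. By translation let
  \<open>\<omega> = 0\<close>. If there is a totally singular plane, with independent vectors \<open>x\<close>, \<open>y\<close>, then the
  triangles \<open>0, x, y\<close> and \<open>0, x, \<lambda>x\<close> with \<open>\<lambda> \<noteq> 0, 1\<close> have different numbers of common neighbours.
  Otherwise the common neighbours of \<open>0\<close> and a singular \<open>x\<close> are the \<open>\<lambda>x\<close>, and for nonsingular \<open>y\<close>
  such a vector is adjacent to \<open>y\<close> iff \<open>\<lambda> B(x, y) = Q(y)\<close>; hence the number of common neighbours
  distinguishes \<open>B(x, y) = 0\<close> from \<open>B(x, y) \<noteq> 0, Q(y)\<close>, although \<open>y\<close> is adjacent to neither
  \<open>0\<close> nor \<open>x\<close> in both cases.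
\<close>

section \<open>Triple intersection numbers\<close>

lemma dual_idempotent_mult_left:
  "(dual_idempotent adj \<omega> i ** M) $ x $ y = scheme_matrix adj i $ \<omega> $ x * M $ x $ y"
  by (simp add: dual_idempotent_def matrix_matrix_mult_def if_distrib[of "\<lambda>a. a * _"] sum.delta
      cong: if_cong)

lemma dual_idempotent_mult_right:
  "(M ** dual_idempotent adj \<omega> i) $ x $ y = M $ x $ y * scheme_matrix adj i $ \<omega> $ y"
  by (simp add: dual_idempotent_def matrix_matrix_mult_def if_distrib[of "\<lambda>a. _ * a"] sum.delta
      cong: if_cong)

lemma scheme_matrix_cong:
  assumes "x = y \<longleftrightarrow> x' = y'" "adj x y \<longleftrightarrow> adj x' y'"
  shows "scheme_matrix adj i $ x $ y = scheme_matrix adj i $ x' $ y'"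
  using assms by (simp add: scheme_matrix_def mat_def adj_matrix_def all_ones_def)

text \<open>The \<open>(x, y)\<close> entry of a generator is a product of entries of
  \<open>A_i\<close>, \<open>A_j\<close>, \<open>A_k\<close> at \<open>(\<omega>, x)\<close>,
  \<open>(x, y)\<close>, \<open>(\<omega>, y)\<close>. Each factor sees only equality and adjacency,
  and this survives linear combination.\<close>

lemma terwilliger_T0_entry_cong:
  assumes "M \<in> terwilliger_T0 adj \<omega>"
    and "\<omega> = x \<longleftrightarrow> \<omega> = x'" "adj \<omega> x \<longleftrightarrow> adj \<omega> x'"
    and "\<omega> = y \<longleftrightarrow> \<omega> = y'" "adj \<omega> y \<longleftrightarrow> adj \<omega> y'"
    and "x = y \<longleftrightarrow> x' = y'" "adj x y \<longleftrightarrow> adj x' y'"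
  shows "M $ x $ y = M $ x' $ y'"
  using assms(1) unfolding terwilliger_T0_def
proof (induction rule: cmat.span_induct_alt)
  case base
  show ?case by simp
next
  case (step c N M)
  then obtain i j k where N:
    "N = dual_idempotent adj \<omega> i ** scheme_matrix adj j ** dual_idempotent adj \<omega> k"
    by blast
  have "N $ x $ y = N $ x' $ y'"
    unfolding N dual_idempotent_mult_right dual_idempotent_mult_left
    using scheme_matrix_cong[where adj = adj, OF assms(2,3)]
      scheme_matrix_cong[where adj = adj, OF assms(4,5)]
      scheme_matrix_cong[where adj = adj, OF assms(6,7)] by simp
  with step show ?case by (simp add: mat_scale_def)
qed

lemma matrix_algebra_terwilliger: "matrix_algebra (terwilliger_algebra adj \<omega>)"
  unfolding terwilliger_algebra_def
  by (rule hull_in) (auto simp: matrix_algebra_def intro!: cmat.subspace_Inter)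

text \<open>The square of the adjacency matrix counts paths \<open>x, z, y\<close>; the idempotent
  in the middle keeps those with \<open>z\<close> adjacent to \<open>\<omega>\<close>.\<close>

lemma common_neighbours_entry:
  fixes adj :: "'v::finite \<Rightarrow> 'v \<Rightarrow> bool"
  shows "(scheme_matrix adj 1 ** dual_idempotent adj \<omega> 1 ** scheme_matrix adj 1) $ x $ y =
    of_nat (card {z. adj \<omega> z \<and> adj x z \<and> adj z y})"
proof -
  have "(scheme_matrix adj 1 ** dual_idempotent adj \<omega> 1 ** scheme_matrix adj 1) $ x $ y =
      (\<Sum>z\<in>UNIV. (scheme_matrix adj 1 ** dual_idempotent adj \<omega> 1) $ x $ z
        * scheme_matrix adj 1 $ z $ y)"
    by (simp add: matrix_matrix_mult_def)
  also have "\<dots> = (\<Sum>z\<in>UNIV. if adj \<omega> z \<and> adj x z \<and> adj z y then 1 else 0)"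
    unfolding dual_idempotent_mult_right
    by (intro sum.cong) (auto simp: scheme_matrix_def adj_matrix_def)
  also have "\<dots> = of_nat (card {z. adj \<omega> z \<and> adj x z \<and> adj z y})"
    by (simp flip: sum.inter_filter)
  finally show ?thesis .
qed

lemma card_common_neighbours_cong:
  fixes adj :: "'v::finite \<Rightarrow> 'v \<Rightarrow> bool"
  assumes "terwilliger_T0 adj \<omega> = terwilliger_algebra adj \<omega>"
    and "\<omega> = x \<longleftrightarrow> \<omega> = x'" "adj \<omega> x \<longleftrightarrow> adj \<omega> x'"
    and "\<omega> = y \<longleftrightarrow> \<omega> = y'" "adj \<omega> y \<longleftrightarrow> adj \<omega> y'"
    and "x = y \<longleftrightarrow> x' = y'" "adj x y \<longleftrightarrow> adj x' y'"
  shows "card {z. adj \<omega> z \<and> adj x z \<and> adj z y} = card {z. adj \<omega> z \<and> adj x' z \<and> adj z y'}"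
proof -
  have "scheme_matrix adj ` {0, 1, 2} \<union> dual_idempotent adj \<omega> ` {0, 1, 2}
      \<subseteq> terwilliger_algebra adj \<omega>"
    unfolding terwilliger_algebra_def by (rule hull_subset)
  then have "scheme_matrix adj 1 ** dual_idempotent adj \<omega> 1 ** scheme_matrix adj 1
      \<in> terwilliger_algebra adj \<omega>"
    using matrix_algebra_terwilliger[of adj \<omega>] by (auto simp: matrix_algebra_def)
  then have "scheme_matrix adj 1 ** dual_idempotent adj \<omega> 1 ** scheme_matrix adj 1
      \<in> terwilliger_T0 adj \<omega>"
    using assms(1) by simp
  from terwilliger_T0_entry_cong[OF this assms(2-)] show ?thesis
    by (simp only: common_neighbours_entry of_nat_eq_iff)
qed

section \<open>Quadratic forms\<close>

lemma polar_form_commute: "polar_form Q x y = polar_form Q y x"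
  by (simp add: polar_form_def algebra_simps)

lemma quadratic_form_add: "Q (x + y) = Q x + Q y + polar_form Q x y"
  by (simp add: polar_form_def)

context
  fixes Q :: "'a::field ^ 'n \<Rightarrow> 'a"
  assumes Q: "quadratic_form Q"
begin

lemma quadratic_form_scale: "Q (c *s x) = c ^ 2 * Q x"
  using Q by (simp add: quadratic_form_def)

lemma polar_form_add_right: "polar_form Q x (y + z) = polar_form Q x y + polar_form Q x z"
  using Q by (simp add: quadratic_form_def Vector_Spaces.linear_iff)

lemma polar_form_scale_right: "polar_form Q x (c *s y) = c * polar_form Q x y"
  using Q by (simp add: quadratic_form_def Vector_Spaces.linear_iff)

lemma polar_form_diff_right: "polar_form Q x (y - z) = polar_form Q x y - polar_form Q x z"
  using polar_form_add_right[of x "y - z" z] by simp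

lemma polar_form_scale_left: "polar_form Q (c *s x) y = c * polar_form Q x y"
  using polar_form_scale_right[of y c x] by (simp add: polar_form_commute)

lemma polar_form_diff_left: "polar_form Q (x - y) z = polar_form Q x z - polar_form Q y z"
  using polar_form_diff_right[of z x y] by (simp add: polar_form_commute)

lemma quadratic_form_zero: "Q 0 = 0"
  using quadratic_form_scale[of 0 0] by simp

lemma quadratic_form_minus: "Q (- x) = Q x"
  using quadratic_form_scale[of "-1" x] by simp

lemma quadratic_form_diff: "Q (x - y) = Q x + Q y - polar_form Q x y"
  using quadratic_form_add[of Q x "- y"] polar_form_scale_right[of x "-1" y]
  by (simp add: quadratic_form_minus)

lemma polar_form_self: "Q x = 0 \<Longrightarrow> polar_form Q x x = 0"
  using quadratic_form_diff[of x x] quadratic_form_zero by simp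

text \<open>As \<open>x\<close> is singular and nonzero, some vector pairs nontrivially with it.
  After scaling the pairing to 1, subtracting \<open>t *s x\<close> lowers the value of
  \<open>Q\<close> by exactly \<open>t\<close>.\<close>

lemma singular_hyperbolic_pair:
  assumes "nondegenerate_form Q" "Q x = 0" "x \<noteq> 0"
  obtains w where "Q w = 0" "polar_form Q x w = 1"
proof -
  obtain u where u: "polar_form Q x u \<noteq> 0"
    using assms unfolding nondegenerate_form_def by blast
  define v where "v = inverse (polar_form Q x u) *s u"
  have v: "polar_form Q x v = 1" "polar_form Q v x = 1"
    using u by (simp_all add: v_def polar_form_scale_right polar_form_commute[of Q _ x])
  show ?thesis
  proof
    show "Q (v - Q v *s x) = 0"
      by (simp add: quadratic_form_diff quadratic_form_scale polar_form_scale_right assms(2) v)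
    show "polar_form Q x (v - Q v *s x) = 1"
      by (simp add: polar_form_diff_right polar_form_scale_right polar_form_self assms(2) v)
  qed
qed

text \<open>Shows that orthogonality to \<open>y\<close> is a genuine extra condition on singular
  vectors orthogonal to \<open>x\<close>. This makes the two counts differ when there is a singular
  plane.\<close>

lemma separating_singular_vector:
  assumes nd: "nondegenerate_form Q" and "Q x = 0" "Q y = 0" "polar_form Q x y = 0"
    and "x \<noteq> 0" and indep: "\<And>c. y \<noteq> c *s x"
  obtains z where "Q z = 0" "polar_form Q x z = 0" "polar_form Q y z \<noteq> 0"
proof -
  obtain w where w: "polar_form Q x w = 1"
    using singular_hyperbolic_pair[OF nd assms(2) assms(5)] by metis
  \<comment> \<open>This makes \<open>y - c *s x\<close> orthogonal to \<open>w\<close>, so moving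
    \<open>v\<close> along \<open>w\<close> into the hyperplane orthogonal to \<open>x\<close> does
    not change its pairing with \<open>y - c *s x\<close>.\<close>
  define c where "c = polar_form Q y w"
  have "Q (y - c *s x) = 0"
    by (simp add: quadratic_form_diff quadratic_form_scale polar_form_scale_right
        polar_form_commute[of Q y] assms)
  moreover have "y - c *s x \<noteq> 0"
    using indep by simp
  ultimately obtain v where v: "polar_form Q (y - c *s x) v \<noteq> 0"
    using nd unfolding nondegenerate_form_def by blast
  define u where "u = v - polar_form Q x v *s w"
  have xu: "polar_form Q x u = 0"
    by (simp add: u_def polar_form_diff_right polar_form_scale_right w)
  have yu: "polar_form Q y u \<noteq> 0"
    using v by (simp add: u_def c_def polar_form_diff_right polar_form_scale_right
        polar_form_diff_left polar_form_scale_left algebra_simps)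
  \<comment> \<open>Since \<open>y\<close> is singular and orthogonal to \<open>x\<close> and to
    itself, adding multiples of \<open>y\<close> changes only \<open>Q\<close>; the coefficient
    solves \<open>Q z = 0\<close>.\<close>
  define z where "z = u - (Q u / polar_form Q y u) *s y"
  show ?thesis
  proof
    show "Q z = 0"
      using yu by (simp add: z_def quadratic_form_diff quadratic_form_scale polar_form_scale_right
          polar_form_commute[of Q u] assms)
    show "polar_form Q x z = 0"
      by (simp add: z_def polar_form_diff_right polar_form_scale_right xu assms)
    show "polar_form Q y z \<noteq> 0"
      using yu by (simp add: z_def polar_form_diff_right polar_form_scale_right polar_form_self assms)
  qed
qed

text \<open>Otherwise \<open>v - polar_form Q x v *s w\<close>, being orthogonal to
  \<open>x\<close>, would be a multiple of \<open>x\<close> for every \<open>v\<close>, and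
  \<open>x\<close>, \<open>w\<close> would span the space.\<close>

lemma orthogonal_independent_vector:
  assumes "CARD('n) > 2" "polar_form Q x w = 1"
  obtains y where "polar_form Q x y = 0" "\<And>c. y \<noteq> c *s x"
proof (rule ccontr)
  assume "\<not> thesis"
  with that have multiple: "\<exists>c. y = c *s x" if "polar_form Q x y = 0" for y
    using \<open>polar_form Q x y = 0\<close> by blast
  have "v \<in> vec.span {x, w}" for v
  proof -
    have "polar_form Q x (v - polar_form Q x v *s w) = 0"
      by (simp add: polar_form_diff_right polar_form_scale_right assms(2))
    from multiple[OF this] obtain c where "v - polar_form Q x v *s w = c *s x" ..
    then have "v = c *s x + polar_form Q x v *s w"
      by (simp add: algebra_simps)
    also have "\<dots> \<in> vec.span {x, w}"
      by (intro vec.span_add vec.span_scale vec.span_base) auto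
    finally show ?thesis .
  qed
  then have "vec.dim (UNIV :: ('a ^ 'n) set) \<le> card {x, w}"
    by (intro vec.dim_le_card) auto
  moreover have "card {x, w} \<le> 2"
    by (simp add: card_insert_if)
  ultimately show False
    using assms(1) by (simp only: vec_dim_card)
qed

end

lemma singular_vector_exists:
  fixes Q :: "'a::{field,finite} ^ 'n \<Rightarrow> 'a"
  assumes "quadratic_form Q" "witt_index Q > 0"
  obtains x where "x \<noteq> 0" "Q x = 0"
proof -
  let ?D = "{vec.dim W | W. totally_singular Q W}"
  have "totally_singular Q {0}"
    using quadratic_form_zero[OF assms(1)] by (simp add: totally_singular_def vec.subspace_def)
  then have "?D \<noteq> {}" by blast
  moreover have "finite ?D" by simp
  ultimately have "witt_index Q \<in> ?D"
    unfolding witt_index_def by (rule Max_in[rotated])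
  then obtain W where W: "totally_singular Q W" "vec.dim W > 0"
    using assms(2) by auto
  then have "\<not> W \<subseteq> {0}"
    by (metis vec.dim_eq_0 less_irrefl)
  with W(1) that show ?thesis
    by (auto simp: totally_singular_def)
qed

section \<open>Affine polar graphs\<close>

lemma VO_adj_translate: "VO_adj Q (\<omega> + x) (\<omega> + y) \<longleftrightarrow> VO_adj Q x y"
  by (simp add: VO_adj_def)

text \<open>Translation by \<open>\<omega>\<close> preserves adjacency, so the counts at
  \<open>\<omega>\<close> may be taken at \<open>0\<close>.\<close>

lemma VO_card_common_neighbours_cong:
  fixes Q :: "'a::{field,finite} ^ 'n \<Rightarrow> 'a"
  assumes T: "terwilliger_T0 (VO_adj Q) \<omega> = terwilliger_algebra (VO_adj Q) \<omega>"
    and "x = 0 \<longleftrightarrow> x' = 0" "VO_adj Q 0 x \<longleftrightarrow> VO_adj Q 0 x'"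
    and "y = 0 \<longleftrightarrow> y' = 0" "VO_adj Q 0 y \<longleftrightarrow> VO_adj Q 0 y'"
    and "x = y \<longleftrightarrow> x' = y'" "VO_adj Q x y \<longleftrightarrow> VO_adj Q x' y'"
  shows "card {z. VO_adj Q 0 z \<and> VO_adj Q x z \<and> VO_adj Q z y} =
    card {z. VO_adj Q 0 z \<and> VO_adj Q x' z \<and> VO_adj Q z y'}"
proof -
  have eq: "card {z. VO_adj Q 0 z \<and> VO_adj Q x z \<and> VO_adj Q z y} =
      card {z. VO_adj Q \<omega> z \<and> VO_adj Q (\<omega> + x) z \<and> VO_adj Q z (\<omega> + y)}" for x y
  proof -
    have "bij_betw ((+) \<omega>) {z. VO_adj Q 0 z \<and> VO_adj Q x z \<and> VO_adj Q z y}
        {z. VO_adj Q \<omega> z \<and> VO_adj Q (\<omega> + x) z \<and> VO_adj Q z (\<omega> + y)}"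
      by (rule bij_betwI[where g = "\<lambda>z. z - \<omega>"])
        (auto simp: VO_adj_def algebra_simps)
    then show ?thesis by (rule bij_betw_same_card)
  qed
  show ?thesis
    unfolding eq
    using assms(2-) VO_adj_translate[of Q \<omega> 0]
    by (intro card_common_neighbours_cong[OF T]) (simp_all add: VO_adj_translate)
qed

lemma T0_neq_T_if_singular_plane:
  fixes Q :: "'a::{field,finite} ^ 'n \<Rightarrow> 'a"
  assumes Q: "quadratic_form Q" and nd: "nondegenerate_form Q"
    and s: "(s::'a) \<noteq> 0" "s \<noteq> 1"
    and x: "Q x = 0" "x \<noteq> 0" and y: "Q y = 0" "polar_form Q x y = 0" "\<And>c. y \<noteq> c *s x"
  shows "terwilliger_T0 (VO_adj Q) \<omega> \<noteq> terwilliger_algebra (VO_adj Q) \<omega>"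
proof
  assume T: "terwilliger_T0 (VO_adj Q) \<omega> = terwilliger_algebra (VO_adj Q) \<omega>"
  note Q_simps = quadratic_form_diff[OF Q] quadratic_form_scale[OF Q] quadratic_form_zero[OF Q]
    quadratic_form_minus[OF Q] polar_form_scale_right[OF Q] polar_form_scale_left[OF Q]
    polar_form_self[OF Q]
  have neq: "y \<noteq> 0" "y \<noteq> x"
    using y(3)[of 0] y(3)[of 1] by auto
  have sx: "s *s x \<noteq> 0" "s *s x \<noteq> x"
    using s x(2) vec.scale_right_imp_eq[of x s 1] by auto
  define C where "C v = {z. VO_adj Q 0 z \<and> VO_adj Q x z \<and> VO_adj Q z v}" for v
  \<comment> \<open>Between singular vectors, a singular difference means orthogonality. Adding the
    three vertices, which adjacency excludes, turns the count into one of singular vectors in an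
    orthogonal complement.\<close>
  have C: "C v \<union> {0, x, v} = {z. Q z = 0 \<and> polar_form Q x z = 0 \<and> polar_form Q v z = 0}"
    if v: "Q v = 0" "polar_form Q x v = 0" for v
  proof -
    have "Q (x - z) = 0 \<longleftrightarrow> polar_form Q x z = 0" "Q (z - v) = 0 \<longleftrightarrow> polar_form Q v z = 0"
      if "Q z = 0" for z
      using that x v by (simp_all add: quadratic_form_diff[OF Q] polar_form_commute[of Q z v])
    moreover have "polar_form Q v x = 0" "polar_form Q x x = 0" "polar_form Q v v = 0"
      using x v by (simp_all add: polar_form_commute[of Q v x] polar_form_self[OF Q])
    moreover have "polar_form Q u 0 = 0" for u
      using polar_form_scale_right[OF Q, of u 0 0] by simp
    ultimately show ?thesis
      using x v by (auto simp: C_def VO_adj_def quadratic_form_zero[OF Q] quadratic_form_minus[OF Q])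
  qed
  have "card (C (s *s x)) = card (C y)"
    unfolding C_def using neq sx x y
    by (intro VO_card_common_neighbours_cong[OF T]) (auto simp: VO_adj_def Q_simps)
  \<comment> \<open>As \<open>s\<close> is nonzero, orthogonality to \<open>s *s x\<close> repeats
    orthogonality to \<open>x\<close>.\<close>
  moreover have "C (s *s x) \<union> {0, x, s *s x} = {z. Q z = 0 \<and> polar_form Q x z = 0}"
    using C[of "s *s x"] x s by (simp add: Q_simps)
  moreover have "card (C y \<union> {0, x, y}) = card (C y) + 3"
    using neq x(2) by (subst card_Un_disjoint) (auto simp: C_def VO_adj_def)
  moreover have "card (C (s *s x) \<union> {0, x, s *s x}) = card (C (s *s x)) + 3"
    using sx x(2) by (subst card_Un_disjoint) (auto simp: C_def VO_adj_def)
  moreover obtain u where "Q u = 0" "polar_form Q x u = 0" "polar_form Q y u \<noteq> 0"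
    using separating_singular_vector[OF Q nd x(1) y(1,2) x(2) y(3)] .
  then have "{z. Q z = 0 \<and> polar_form Q x z = 0 \<and> polar_form Q y z = 0}
      \<subset> {z. Q z = 0 \<and> polar_form Q x z = 0}"
    by blast
  then have "card {z. Q z = 0 \<and> polar_form Q x z = 0 \<and> polar_form Q y z = 0}
      < card {z. Q z = 0 \<and> polar_form Q x z = 0}"
    by (intro psubset_card_mono) simp_all
  ultimately show False
    using C[OF y(1,2)] by simp
qed

lemma T0_neq_T_if_no_singular_plane:
  fixes Q :: "'a::{field,finite} ^ 'n \<Rightarrow> 'a"
  assumes Q: "quadratic_form Q" and nd: "nondegenerate_form Q" and n: "CARD('n) > 2"
    and s: "(s::'a) \<noteq> 0" "s \<noteq> 1"
    and x: "Q x = 0" "x \<noteq> 0"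
    and multiple: "\<And>y. Q y = 0 \<Longrightarrow> polar_form Q x y = 0 \<Longrightarrow> \<exists>c. y = c *s x"
  shows "terwilliger_T0 (VO_adj Q) \<omega> \<noteq> terwilliger_algebra (VO_adj Q) \<omega>"
proof
  assume T: "terwilliger_T0 (VO_adj Q) \<omega> = terwilliger_algebra (VO_adj Q) \<omega>"
  note Q_simps = quadratic_form_diff[OF Q] quadratic_form_scale[OF Q] quadratic_form_zero[OF Q]
    quadratic_form_minus[OF Q] polar_form_scale_right[OF Q] polar_form_scale_left[OF Q]
    polar_form_self[OF Q]
  obtain w where w: "Q w = 0" "polar_form Q x w = 1"
    using singular_hyperbolic_pair[OF Q nd x] .
  obtain y where y: "polar_form Q x y = 0" "\<And>c. y \<noteq> c *s x"
    using orthogonal_independent_vector[OF Q n w(2)] by blast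
  have Qy: "Q y \<noteq> 0"
    using multiple y by blast
  \<comment> \<open>Here \<open>Q v = s\<close> and \<open>Q (x - v) = s - 1\<close>, so
    \<open>v\<close>, like \<open>y\<close>, is adjacent to neither \<open>0\<close> nor
    \<open>x\<close>.\<close>
  define v where "v = s *s x + w"
  have v: "Q v = s" "polar_form Q x v = 1"
    by (simp_all add: v_def quadratic_form_add[of Q] polar_form_add_right[OF Q] Q_simps x w)
  define C where "C y = {z. VO_adj Q 0 z \<and> VO_adj Q x z \<and> VO_adj Q z y}" for y
  have nonzero: "y \<noteq> 0" "v \<noteq> 0" "x \<noteq> y" "x \<noteq> v"
    using Qy v s x quadratic_form_zero[OF Q] by auto
  have "card (C y) = card (C v)"
    unfolding C_def using nonzero x Qy y(1) v s
    by (intro VO_card_common_neighbours_cong[OF T]) (auto simp: VO_adj_def Q_simps)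
  moreover have "C y = {}"
  proof -
    have False if "z \<in> C y" for z
    proof -
      from that have z: "Q z = 0" "polar_form Q x z = 0" "Q (z - y) = 0"
        using x by (auto simp: C_def VO_adj_def Q_simps)
      then obtain c where "z = c *s x"
        using multiple by blast
      with z(3) show False
        using x y(1) Qy by (simp add: Q_simps)
    qed
    then show ?thesis by blast
  qed
  \<comment> \<open>The difference \<open>s *s x - v\<close> is \<open>- w\<close>, which is
    singular.\<close>
  moreover have "s *s x \<in> C v"
  proof -
    have "s *s x \<noteq> x" "s *s x \<noteq> v"
      using s x(2) vec.scale_right_imp_eq[of x s 1] v x(1) quadratic_form_scale[OF Q, of s x]
      by auto
    then show ?thesis
      using s x v by (auto simp: C_def VO_adj_def Q_simps)
  qed
  ultimately show False by simp
qed

theorem theorem6p10: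
  fixes Q :: "('a::{field,finite}) ^ 'n \<Rightarrow> 'a"
    and \<epsilon> :: int and q m :: nat
  assumes "\<epsilon> = 1 \<or> \<epsilon> = - 1"
    and "CARD('a) = q" and "q > 2"
    and "CARD('n) = 2 * m" and "m \<ge> 2"
    and "quadratic_form Q" and "nondegenerate_form Q" and "form_type \<epsilon> Q"
  shows "\<not> triply_transitive (VO_adj Q)"
proof -
  \<comment> \<open>The Witt index is \<open>m\<close> or \<open>m - 1\<close>, hence positive
    because \<open>m\<close> is at least 2.\<close>
  have "witt_index Q > 0"
    using assms(4,5,8) by (auto simp: form_type_def hyperbolic_def elliptic_def)
  then obtain x where x: "x \<noteq> 0" "Q x = 0"
    using singular_vector_exists assms(6) by metis
  have "\<not> (UNIV :: 'a set) \<subseteq> {0, 1}"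
    using card_mono[of "{0, 1}" "UNIV :: 'a set"] assms(2,3) by auto
  then obtain s :: 'a where s: "s \<noteq> 0" "s \<noteq> 1"
    by blast
  have "terwilliger_T0 (VO_adj Q) \<omega> \<noteq> terwilliger_algebra (VO_adj Q) \<omega>" for \<omega>
  \<comment> \<open>Such a \<open>y\<close> spans a totally singular plane with \<open>x\<close>, so
    the split is on planes through this one \<open>x\<close>.\<close>
  proof (cases "\<exists>y. Q y = 0 \<and> polar_form Q x y = 0 \<and> (\<forall>c. y \<noteq> c *s x)")
    case True
    then show ?thesis
      using T0_neq_T_if_singular_plane[OF assms(6,7) s x(2,1)] by blast
  next
    case False
    moreover have "CARD('n) > 2"
      using assms(4,5) by simp
    ultimately show ?thesis
      using T0_neq_T_if_no_singular_plane[OF assms(6,7) _ s x(2,1)] by blast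
  qed
  then show ?thesis
    by (simp add: triply_transitive_def)
qed

end
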